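(* Let $\Omega\subseteq\mathbb{R}^n$ be open, $\mathbf{C}\subset\Omega$ a closed target with compact boundary, $U=\mathbb{R}^m$, and $d\ge1$ an integer. Let $f_0$ and $f_{\alpha}=f_{\alpha_1,\dots,\alpha_m}$ ($\alpha\in\mathbb{N}^m$, $1\le\alpha_1+\dots+\alpha_m\le d$) be continuous vector fields on $\Omega$ with values in $\mathbb{R}^n$, and set $$f(x,u):=f_0(x)+\sum_{i=1}^d\ \sum_{\alpha\in\mathbb{N}^m,\ \alpha_1+\dots+\alpha_m=i}u_1^{\alpha_1}\cdots u_m^{\alpha_m}f_{\alpha_1,\dots,\alpha_m}(x),$$ $$f^{max}(x,u):=f_0(x)+\sum_{\alpha\in\mathbb{N}^m,\ \alpha_1+\dots+\alpha_m=d}u_1^{\alpha_1}\cdots u_m^{\alpha_m}f_{\alpha_1,\dots,\alpha_m}(x).$$ Assume that the running cost has the form $l(x,u)=M_0(x)+M_1(x,u)$, where $M_0,M_1$ are non-negative continuous functions such that $$M_1(x,0)=0,\qquad M_1(x,ku)\le k^dM_1(x,u)\qquad\forall k\ge1,\ x\in\Omega\setminus\mathbf{C},\ u\in\mathbb{R}^m.$$ Let $p_0\ge0$. If $W$ is a $p_0$-Minimum Restraint Function for $(l,f^{max},\mathbf{C})$ in $\Omega$, then $W$ is also a $p_0$-Minimum Restraint Function for $(l,f,\mathbf{C})$ in $\Omega$.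
   Context: $k$ ranges over real numbers $\ge 1$. For a dynamics $g:\Omega\times\mathbb{R}^m\to\mathbb{R}^n$ the Hamiltonian is $H_{l,g}(x,p_0,p):=\inf_{u\in\mathbb{R}^m}\{\langle p,g(x,u)\rangle+p_0\,l(x,u)\}\in[-\infty,+\infty[$. Limiting gradients: for a locally Lipschitz $F$ on an open set, $D^*F(x)$ is the set of all limits $\lim_k\nabla F(x_k)$ with $x_k\to x$, $x_k\ne x$, $F$ differentiable at $x_k$. $p_0$-Minimum Restraint Function ($p_0$-MRF) for $(l,g,\mathbf{C})$ in $\Omega$: a continuous $W:\Omega\setminus\overset{\circ}{\mathbf{C}}\to[0,+\infty[$ such that (1) $W$ is locally semiconcave on $\Omega\setminus\mathbf{C}$: for every compact $\mathcal{K}\subset\Omega\setminus\mathbf{C}$ there is $\rho>0$ with $W(z_1)+W(z_2)-2W(\frac{z_1+z_2}{2})\le\rho|z_1-z_2|^2$ whenever the segment $[z_1,z_2]\subseteq\mathcal{K}$ (in particular $W$ is locally Lipschitz there); (2) $W$ is positive definite: $W>0$ on $\Omega\setminus\mathbf{C}$ and $W=0$ on $\partial\mathbf{C}$; (3) $W$ is proper: $W^{-1}(K)$ is compact for every compact $K\subset[0,+\infty)$; (4) $H_{l,g}(x,p_0,p)<0$ for all $x\in\Omega\setminus\mathbf{C}$ and all $p\in D^*W(x)$ (the value $-\infty$ is allowed); (5) there is $W_0\in[0,+\infty]$ such that $W(x)<W_0$ for all $x\in\Omega\setminus\mathbf{C}$ and $\lim_{x\to x_0,\,x\in\Omega}W(x)=W_0$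 for every $x_0\in\partial\Omega$. *)

theory Defs
  imports "HOL-Analysis.Analysis"
begin

definition mdegree :: "nat ^ 'm \<Rightarrow> nat" where
  "mdegree \<alpha> = (\<Sum>j\<in>UNIV. \<alpha> $ j)"

definition mmonomial :: "nat ^ 'm \<Rightarrow> real ^ 'm \<Rightarrow> real" where
  "mmonomial \<alpha> u = (\<Prod>j\<in>UNIV. (u $ j) ^ (\<alpha> $ j))"

(* The sums over multi-indices in poly_dynamics and max_dynamics are finite sums. *)
lemma finite_mdegree: "finite {\<alpha> :: nat ^ 'm. mdegree \<alpha> = i}"
proof -
  have "{\<alpha> :: nat ^ 'm. mdegree \<alpha> = i} \<subseteq> vec_lambda ` (UNIV \<rightarrow>\<^sub>E {..i})"
  proof
    fix \<alpha> :: "nat ^ 'm"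
    assume "\<alpha> \<in> {\<alpha>. mdegree \<alpha> = i}"
    then have "\<alpha> $ j \<le> i" for j
      unfolding mdegree_def by (auto intro: member_le_sum)
    then have "(\<lambda>j. \<alpha> $ j) \<in> UNIV \<rightarrow>\<^sub>E {..i}"
      by auto
    then show "\<alpha> \<in> vec_lambda ` (UNIV \<rightarrow>\<^sub>E {..i})"
      by (metis image_eqI vec_nth_inverse)
  qed
  then show ?thesis
    by (rule finite_subset) (intro finite_imageI finite_PiE, auto)
qed

definition poly_dynamics ::
  "nat \<Rightarrow> (real ^ 'n \<Rightarrow> real ^ 'n) \<Rightarrow> (nat ^ 'm \<Rightarrow> real ^ 'n \<Rightarrow> real ^ 'n)
    \<Rightarrow> real ^ 'n \<Rightarrow> real ^ 'm \<Rightarrow> real ^ 'n" where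
  "poly_dynamics d f0 F x u =
     f0 x + (\<Sum>i = 1..d. \<Sum>\<alpha> | mdegree \<alpha> = i. mmonomial \<alpha> u *\<^sub>R F \<alpha> x)"

definition max_dynamics ::
  "nat \<Rightarrow> (real ^ 'n \<Rightarrow> real ^ 'n) \<Rightarrow> (nat ^ 'm \<Rightarrow> real ^ 'n \<Rightarrow> real ^ 'n)
    \<Rightarrow> real ^ 'n \<Rightarrow> real ^ 'm \<Rightarrow> real ^ 'n" where
  "max_dynamics d f0 F x u =
     f0 x + (\<Sum>\<alpha> | mdegree \<alpha> = d. mmonomial \<alpha> u *\<^sub>R F \<alpha> x)"

definition hamiltonian ::
  "(real ^ 'n \<Rightarrow> real ^ 'm \<Rightarrow> real) \<Rightarrow> (real ^ 'n \<Rightarrow> real ^ 'm \<Rightarrow> real ^ 'n)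
    \<Rightarrow> real ^ 'n \<Rightarrow> real \<Rightarrow> real ^ 'n \<Rightarrow> ereal" where
  "hamiltonian l g x p0 p = (INF u. ereal (p \<bullet> g x u + p0 * l x u))"

(* For S open; differentiability at a point of S then depends only on the restriction of F to S. *)
definition limiting_gradients ::
  "(real ^ 'n) set \<Rightarrow> (real ^ 'n \<Rightarrow> real) \<Rightarrow> real ^ 'n \<Rightarrow> (real ^ 'n) set" where
  "limiting_gradients S F x =
     {p. \<exists>X G. (\<forall>k. X k \<in> S \<and> X k \<noteq> x \<and> GDERIV F (X k) :> G k) \<and>
               X \<longlonglongrightarrow> x \<and> G \<longlonglongrightarrow> p}"

definition locally_semiconcave_on :: "(real ^ 'n) set \<Rightarrow> (real ^ 'n \<Rightarrow> real) \<Rightarrow> bool" where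
  "locally_semiconcave_on S F \<longleftrightarrow>
     (\<forall>K. compact K \<and> K \<subseteq> S \<longrightarrow>
        (\<exists>\<rho>>0. \<forall>z1 z2. closed_segment z1 z2 \<subseteq> K \<longrightarrow>
           F z1 + F z2 - 2 * F (midpoint z1 z2) \<le> \<rho> * (norm (z1 - z2))\<^sup>2))"

(* W is a total function here; only its values on the set Omega - interior C matter
   (C being closed and contained in the open set Omega). *)
definition min_restraint_function ::
  "real \<Rightarrow> (real ^ 'n \<Rightarrow> real ^ 'm \<Rightarrow> real) \<Rightarrow> (real ^ 'n \<Rightarrow> real ^ 'm \<Rightarrow> real ^ 'n)
    \<Rightarrow> (real ^ 'n) set \<Rightarrow> (real ^ 'n) set \<Rightarrow> (real ^ 'n \<Rightarrow> real) \<Rightarrow> bool" where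
  "min_restraint_function p0 l g C \<Omega> W \<longleftrightarrow>
     continuous_on (\<Omega> - interior C) W \<and>
     (\<forall>x \<in> \<Omega> - interior C. 0 \<le> W x) \<and>
     locally_semiconcave_on (\<Omega> - C) W \<and>
     (\<forall>x \<in> \<Omega> - C. 0 < W x) \<and> (\<forall>x \<in> frontier C. W x = 0) \<and>
     (\<forall>K. compact K \<and> K \<subseteq> {0..} \<longrightarrow> compact {x \<in> \<Omega> - interior C. W x \<in> K}) \<and>
     (\<forall>x \<in> \<Omega> - C. \<forall>p \<in> limiting_gradients (\<Omega> - C) W x. hamiltonian l g x p0 p < 0) \<and>
     (\<exists>W0 :: ereal. 0 \<le> W0 \<and> (\<forall>x \<in> \<Omega> - C. ereal (W x) < W0) \<and>
        (\<forall>x0 \<in> frontier \<Omega>. ((\<lambda>x. ereal (W x)) \<longlongrightarrow> W0) (at x0 within \<Omega>)))"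

end

(* Only the sign of the Hamiltonian depends on the dynamics, and it can be compared pointwise.
   Suppose a control u makes the Hamiltonian of the maximal dynamics negative, and let
   a = <p, f0(x)> + p0 M0(x) be its u-independent part. If a < 0, the control 0 works for the full
   dynamics. Otherwise the u-dependent part is negative; along the ray k u it scales at most like
   k^d, whereas the terms of degree less than d grow at most like k^(d-1), so a large k works. *)
theory Submission
  imports Defs
begin

lemma mmonomial_scaleR: "mmonomial \<alpha> (k *\<^sub>R u) = k ^ mdegree \<alpha> * mmonomial \<alpha> u"
  by (simp add: mmonomial_def mdegree_def power_mult_distrib prod.distrib power_sum)

lemma mmonomial_zero:
  assumes "mdegree \<alpha> \<noteq> 0"
  shows "mmonomial \<alpha> 0 = 0"
  using assms by (auto simp: mmonomial_def mdegree_def)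

lemma homogeneous_sum_scaleR:
  fixes v :: "nat ^ 'm \<Rightarrow> 'a::real_vector"
  shows "(\<Sum>\<alpha> | mdegree \<alpha> = i. mmonomial \<alpha> (k *\<^sub>R u) *\<^sub>R v \<alpha>)
    = k ^ i *\<^sub>R (\<Sum>\<alpha> | mdegree \<alpha> = i. mmonomial \<alpha> u *\<^sub>R v \<alpha>)"
  by (simp add: mmonomial_scaleR scaleR_sum_right)

lemma poly_dynamics_zero: "poly_dynamics d f0 F x 0 = f0 x"
  by (simp add: poly_dynamics_def mmonomial_zero)

text \<open>For \<open>k\<close> \<ge> 1 the constant and each term of degree at most
  \<open>n\<close> are bounded by \<open>k ^ n\<close> times the modulus of their coefficient.
  Factoring out \<open>k ^ n\<close> leaves the affine function \<open>B + k * b\<close>, which is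
  negative for large \<open>k\<close>.\<close>

lemma polynomial_eventually_negative:
  fixes a b :: real and c :: "nat \<Rightarrow> real"
  assumes "b < 0"
  obtains k where "1 \<le> k" "a + (\<Sum>i = 1..n. k ^ i * c i) + k ^ Suc n * b < 0"
proof -
  define B where "B = \<bar>a\<bar> + (\<Sum>i = 1..n. \<bar>c i\<bar>)"
  \<comment> \<open>The root of \<open>B + k * b\<close> is \<open>B / (- b)\<close>; the summand 1
    makes \<open>k\<close> exceed it strictly, and the maximum with 1 makes the powers of
    \<open>k\<close> nondecreasing in the exponent.\<close>
  define k where "k = max 1 (B / (- b) + 1)"
  have k: "1 \<le> k" "B / (- b) < k"
    by (auto simp: k_def)
  have "B + k * b < 0"
    using k(2) assms by (simp add: field_simps)
  have "a \<le> k ^ n * \<bar>a\<bar>"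
    using mult_right_mono[OF one_le_power[OF k(1)], of "\<bar>a\<bar>" n] by simp
  moreover have "k ^ i * c i \<le> k ^ n * \<bar>c i\<bar>" if "i \<le> n" for i
    \<comment> \<open>The intermediate term is \<open>k ^ i * \<bar>c i\<bar>\<close>.\<close>
    using k(1) that by (intro order_trans[OF mult_left_mono mult_right_mono] power_increasing) auto
  then have "(\<Sum>i = 1..n. k ^ i * c i) \<le> (\<Sum>i = 1..n. k ^ n * \<bar>c i\<bar>)"
    by (intro sum_mono) simp
  ultimately have "a + (\<Sum>i = 1..n. k ^ i * c i) + k ^ Suc n * b \<le> k ^ n * (B + k * b)"
    by (simp add: B_def algebra_simps sum_distrib_left)
  also have "\<dots> < 0"
    using k(1) \<open>B + k * b < 0\<close> by (intro mult_pos_neg) auto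
  finally show thesis
    using that k(1) by blast
qed

text \<open>An infimum lies strictly below 0 exactly when one of the values does, so the infimum
  need not be attained and the value -\<infinity> is covered.\<close>

lemma hamiltonian_less_0_iff:
  "hamiltonian l g x p0 p < 0 \<longleftrightarrow> (\<exists>u. p \<bullet> g x u + p0 * l x u < 0)"
  by (simp add: hamiltonian_def INF_less_iff)

text \<open>The point \<open>x\<close> and the covector \<open>p\<close> are fixed, so
  \<open>M0\<close> is a number and \<open>M1\<close> a function of the control alone.\<close>

lemma hamiltonian_poly_dynamics_less_0:
  fixes F :: "nat ^ 'm \<Rightarrow> real ^ 'n \<Rightarrow> real ^ 'n"
  assumes "d \<ge> 1" and "p0 \<ge> 0"
    and l: "\<And>u. l x u = M0 + M1 u"
    and M1_0: "M1 0 = 0"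
    and M1_scale: "\<And>(k::real) u. k \<ge> 1 \<Longrightarrow> M1 (k *\<^sub>R u) \<le> k ^ d * M1 u"
    and neg: "hamiltonian l (max_dynamics d f0 F) x p0 p < 0"
  shows "hamiltonian l (poly_dynamics d f0 F) x p0 p < 0"
proof -
  define a where "a = p \<bullet> f0 x + p0 * M0"
  define P where "P i u = p \<bullet> (\<Sum>\<alpha> | mdegree \<alpha> = i. mmonomial \<alpha> u *\<^sub>R F \<alpha> x)" for i u
  \<comment> \<open>This splits off the top degree, the part shared with the maximal dynamics; for
    \<open>d = 1\<close> the sum of lower terms is empty.\<close>
  obtain n where d: "d = Suc n"
    using \<open>d \<ge> 1\<close> by (cases d) auto
  have poly: "p \<bullet> poly_dynamics d f0 F x u + p0 * l x u
      = a + (\<Sum>i = 1..n. P i u) + (P d u + p0 * M1 u)" for u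
    by (simp add: d poly_dynamics_def a_def P_def l inner_add_right inner_sum_right distrib_left)
  obtain u where u: "a + (P d u + p0 * M1 u) < 0"
    using neg by (auto simp: hamiltonian_less_0_iff max_dynamics_def a_def P_def l
        inner_add_right distrib_left add_ac)
  show ?thesis
  proof (cases "a < 0")
    case True
    then have "p \<bullet> poly_dynamics d f0 F x 0 + p0 * l x 0 < 0"
      by (simp add: poly_dynamics_zero a_def l M1_0)
    then show ?thesis
      by (auto simp: hamiltonian_less_0_iff)
  next
    case False
    then have "P d u + p0 * M1 u < 0"
      using u by simp
    then obtain k where "1 \<le> k"
      and k: "a + (\<Sum>i = 1..n. k ^ i * P i u) + k ^ Suc n * (P d u + p0 * M1 u) < 0"
      by (rule polynomial_eventually_negative)
    have P_scale: "P i (k *\<^sub>R u) = k ^ i * P i u" for i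
      by (simp add: P_def homogeneous_sum_scaleR)
    \<comment> \<open>\<open>P\<close> scales exactly but \<open>M1\<close> only by an inequality;
      the sign of \<open>p0\<close> keeps it an upper bound.\<close>
    have "p0 * M1 (k *\<^sub>R u) \<le> p0 * (k ^ d * M1 u)"
      using \<open>1 \<le> k\<close> \<open>p0 \<ge> 0\<close> by (intro mult_left_mono M1_scale)
    then have "p \<bullet> poly_dynamics d f0 F x (k *\<^sub>R u) + p0 * l x (k *\<^sub>R u) < 0"
      using k unfolding poly P_scale by (simp add: d distrib_left mult.left_commute[of p0])
    then show ?thesis
      by (auto simp: hamiltonian_less_0_iff)
  qed
qed

theorem theorem1p2:
  fixes \<Omega> C :: "(real ^ 'n) set"
    and d :: nat
    and f0 :: "real ^ 'n \<Rightarrow> real ^ 'n"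
    and F :: "nat ^ 'm \<Rightarrow> real ^ 'n \<Rightarrow> real ^ 'n"
    and l M1 :: "real ^ 'n \<Rightarrow> real ^ 'm \<Rightarrow> real"
    and M0 W :: "real ^ 'n \<Rightarrow> real"
    and p0 :: real
  assumes "open \<Omega>"
    and "closed C" and "C \<subseteq> \<Omega>" and "compact (frontier C)"
    and "d \<ge> 1"
    and "continuous_on \<Omega> f0"
    and "\<And>\<alpha>. 1 \<le> mdegree \<alpha> \<Longrightarrow> mdegree \<alpha> \<le> d \<Longrightarrow> continuous_on \<Omega> (F \<alpha>)"
    and "\<And>x u. x \<in> \<Omega> \<Longrightarrow> l x u = M0 x + M1 x u"
    and "continuous_on \<Omega> M0"
    and "continuous_on (\<Omega> \<times> UNIV) (\<lambda>(x, u). M1 x u)"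
    and "\<And>x. x \<in> \<Omega> \<Longrightarrow> 0 \<le> M0 x"
    and "\<And>x u. x \<in> \<Omega> \<Longrightarrow> 0 \<le> M1 x u"
    and "\<And>x. x \<in> \<Omega> - C \<Longrightarrow> M1 x 0 = 0"
    and "\<And>(k::real) x u. k \<ge> 1 \<Longrightarrow> x \<in> \<Omega> - C \<Longrightarrow> M1 x (k *\<^sub>R u) \<le> k ^ d * M1 x u"
    and "p0 \<ge> 0"
    and "min_restraint_function p0 l (max_dynamics d f0 F) C \<Omega> W"
  shows "min_restraint_function p0 l (poly_dynamics d f0 F) C \<Omega> W"
proof -
  have "hamiltonian l (poly_dynamics d f0 F) x p0 p < 0"
    if x: "x \<in> \<Omega> - C" and p: "p \<in> limiting_gradients (\<Omega> - C) W x" for x p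
  \<comment> \<open>Applied with \<open>M0 x\<close> and \<open>M1 x\<close>; \<open>x\<close> lies
    outside \<open>C\<close>, where the scaling hypotheses on \<open>M1\<close> hold.\<close>
  proof (rule hamiltonian_poly_dynamics_less_0)
    show "l x u = M0 x + M1 x u" for u
      using x assms(8) by simp
    show "hamiltonian l (max_dynamics d f0 F) x p0 p < 0"
      using assms(16) x p unfolding min_restraint_function_def by blast
  qed (use x assms(5,13,14,15) in auto)
  then show ?thesis
    using assms(16) unfolding min_restraint_function_def by blast
qed

end
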